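(* Let $k$ be a field and $R = k[x_1,\dots,x_d]$. Let $I \subseteq R$ be a square-free monomial ideal such that every proper minor of $I$ is normally torsion-free. Let $y_1,\dots,y_s$ be distinct variables in $R$ (that is, distinct elements of $\{x_1,\dots,x_d\}$), let $\mathfrak m = (x_1,\dots,x_d)$ be the maximal homogeneous ideal of $R$, and let $t$ be a positive integer. Then $\mathfrak m \in \operatorname{Ass}(R/I^t)$ if and only if $\mathfrak m \in \operatorname{Ass}\bigl(R/(I^t : \prod_{i=1}^s y_i)\bigr)$.
   Context: Normally torsion-free: an ideal $I$ of a Noetherian ring $R$ is normally torsion-free if $\operatorname{Ass}(R/I^t) = \operatorname{Ass}(R/I)$ for all $t \ge 1$. Minors: let $I \subseteq k[x_1,\dots,x_d]$ be a square-free monomial ideal and $x$ one of the variables. The deletion of $x$ is the ideal, in the polynomial ring on the remaining variables, generated by the images of the generators of $I$ after setting $x=0$ (i.e. by the minimal monomial generators of $I$ not divisible by $x$). The contraction of $x$ is the ideal, in the polynomial ring on the remaining variables, generated by the images of the generators of $I$ after setting $x=1$. A minor of $I$ is an ideal obtained from $I$ by a sequence of deletions and contractions; it is proper if at least one deletion or contraction is performed.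
   Formalization: The formal theorem additionally assumes I ≠ 𝔪 or s < t; for I = 𝔪 and s ≥ t the claim is false (e.g. R = k[x], I = (x), s = t = 1: 𝔪 ∈ Ass(R/I), but I : x = R, so Ass is empty). *)

theory Defs
  imports
    "HOL-Library.Poly_Mapping"
    "HOL-Algebra.Module"
    "HOL-Algebra.QuotRing"
    "HOL-Algebra.Ideal_Product"
begin

section \<open>Associated primes, colon ideals, normally torsion-free ideals\<close>

definition annihilator :: "('a, 'm) ring_scheme \<Rightarrow> ('a, 'b, 'n) module_scheme \<Rightarrow> 'b \<Rightarrow> 'a set" where
  "annihilator R M m = {r \<in> carrier R. r \<odot>\<^bsub>M\<^esub> m = \<zero>\<^bsub>M\<^esub>}"

definition Ass :: "('a, 'm) ring_scheme \<Rightarrow> ('a, 'b, 'n) module_scheme \<Rightarrow> 'a set set" where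
  "Ass R M = {P. primeideal P R \<and> (\<exists>m \<in> carrier M. P = annihilator R M m)}"

text \<open>The quotient \<open>R / J\<close> regarded as an \<open>R\<close>-module.\<close>

definition quot_module :: "('a, 'm) ring_scheme \<Rightarrow> 'a set \<Rightarrow> ('a, 'a set) module" where
  "quot_module R J =
     \<lparr>carrier = carrier (R Quot J), mult = mult (R Quot J), one = one (R Quot J),
      zero = zero (R Quot J), add = add (R Quot J),
      smult = (\<lambda>r X. (J +>\<^bsub>R\<^esub> r) \<otimes>\<^bsub>R Quot J\<^esub> X)\<rparr>"

definition colon :: "('a, 'm) ring_scheme \<Rightarrow> 'a set \<Rightarrow> 'a \<Rightarrow> 'a set" where
  "colon R J f = {r \<in> carrier R. r \<otimes>\<^bsub>R\<^esub> f \<in> J}"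

definition ideal_power :: "('a, 'm) ring_scheme \<Rightarrow> 'a set \<Rightarrow> nat \<Rightarrow> 'a set" where
  "ideal_power R I t = I [^]\<^bsub>ideals_set R\<^esub> t"

definition normally_torsion_free :: "('a, 'm) ring_scheme \<Rightarrow> 'a set \<Rightarrow> bool" where
  "normally_torsion_free R I \<longleftrightarrow>
     (\<forall>t::nat. t \<ge> 1 \<longrightarrow> Ass R (quot_module R (ideal_power R I t)) = Ass R (quot_module R I))"

lemma annihilator_quot_module:
  assumes "cring R" "ideal J R" "f \<in> carrier R"
  shows "annihilator R (quot_module R J) (J +>\<^bsub>R\<^esub> f) = colon R J f"
proof -
  interpret cring R by fact
  interpret J: ideal J R by fact
  have "(J +>\<^bsub>R\<^esub> r) \<otimes>\<^bsub>R Quot J\<^esub> (J +>\<^bsub>R\<^esub> f) = \<zero>\<^bsub>R Quot J\<^esub> \<longleftrightarrow> r \<otimes>\<^bsub>R\<^esub> f \<in> J"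
    if r: "r \<in> carrier R" for r
  proof -
    have "(J +>\<^bsub>R\<^esub> r) \<otimes>\<^bsub>R Quot J\<^esub> (J +>\<^bsub>R\<^esub> f) = J +>\<^bsub>R\<^esub> (r \<otimes>\<^bsub>R\<^esub> f)"
      using r assms(3) J.rcoset_mult_add by (simp add: FactRing_def)
    then show ?thesis
      using r assms(3) J.a_rcos_const J.a_rcos_self by (auto simp: FactRing_def)
  qed
  then show ?thesis
    by (auto simp: annihilator_def quot_module_def colon_def)
qed

lemma Ass_quot_module:
  assumes "cring R" "ideal J R"
  shows "Ass R (quot_module R J) = {P. primeideal P R \<and> (\<exists>f \<in> carrier R. P = colon R J f)}"
proof -
  have "carrier (quot_module R J) = (\<lambda>f. J +>\<^bsub>R\<^esub> f) ` carrier R"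
    by (auto simp: quot_module_def FactRing_def A_RCOSETS_def')
  then show ?thesis
    using annihilator_quot_module[OF assms] by (auto simp: Ass_def)
qed

lemma module_quot_module:
  assumes "cring R" "ideal J R"
  shows "module R (quot_module R J)"
proof -
  interpret cring R by fact
  interpret J: ideal J R by fact
  interpret Q: cring "R Quot J" by (rule J.quotient_is_cring) fact
  have hom: "(\<lambda>r. J +>\<^bsub>R\<^esub> r) \<in> ring_hom R (R Quot J)"
    by (rule J.rcos_ring_hom)
  note h = ring_hom_closed[OF hom] ring_hom_mult[OF hom] ring_hom_add[OF hom] ring_hom_one[OF hom]
  have ag: "abelian_group (quot_module R J)"
  proof (rule abelian_groupI)
    fix X assume "X \<in> carrier (quot_module R J)"
    then show "\<exists>Y \<in> carrier (quot_module R J). Y \<oplus>\<^bsub>quot_module R J\<^esub> X = \<zero>\<^bsub>quot_module R J\<^esub>"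
      by (intro bexI[of _ "\<ominus>\<^bsub>R Quot J\<^esub> X"]) (simp_all add: quot_module_def Q.l_neg)
  qed (simp_all add: quot_module_def, metis Q.a_assoc, metis Q.a_comm)
  show ?thesis
    by (rule moduleI[OF assms(1) ag])
      (simp_all add: quot_module_def h Q.l_distr Q.r_distr Q.m_assoc)
qed


section \<open>Polynomial rings\<close>

text \<open>
  A monomial is its exponent vector \<open>nat \<Rightarrow>\<^sub>0 nat\<close>, and a polynomial maps monomials to
  coefficients. All polynomials, in the variables \<open>x\<^sub>0, x\<^sub>1, \<dots>\<close>, share one type;
  \<open>poly_ring V\<close> is the ring \<open>k[x\<^sub>v : v \<in> V]\<close>.
\<close>

type_synonym 'k mvpoly = "(nat \<Rightarrow>\<^sub>0 nat) \<Rightarrow>\<^sub>0 'k"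

definition poly_ring :: "nat set \<Rightarrow> 'k::field mvpoly ring" where
  "poly_ring V =
     \<lparr>carrier = {p. \<forall>m \<in> Poly_Mapping.keys p. Poly_Mapping.keys m \<subseteq> V},
      mult = (*), one = 1, zero = 0, add = (+)\<rparr>"

definition mon :: "(nat \<Rightarrow>\<^sub>0 nat) \<Rightarrow> 'k::field mvpoly" where
  "mon m = Poly_Mapping.single m 1"

definition var :: "nat \<Rightarrow> 'k::field mvpoly" where
  "var v = mon (Poly_Mapping.single v 1)"

definition maximal_homogeneous_ideal :: "nat set \<Rightarrow> 'k::field mvpoly set" where
  "maximal_homogeneous_ideal V = Idl\<^bsub>poly_ring V\<^esub> (var ` V)"

lemma cring_poly_ring: "cring (poly_ring V :: 'k::field mvpoly ring)"
proof (rule cringI)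
  let ?R = "poly_ring V :: 'k mvpoly ring"
  have add: "p \<oplus>\<^bsub>?R\<^esub> q \<in> carrier ?R" if "p \<in> carrier ?R" "q \<in> carrier ?R" for p q
    using that keys_add[of p q] unfolding poly_ring_def by auto
  have mult: "p \<otimes>\<^bsub>?R\<^esub> q \<in> carrier ?R" if "p \<in> carrier ?R" "q \<in> carrier ?R" for p q
    unfolding poly_ring_def
  proof (clarsimp, rule ccontr)
    fix m v
    assume m: "m \<in> Poly_Mapping.keys (p * q)" and v: "v \<in> Poly_Mapping.keys m" "\<not> v \<in> V"
    obtain a b where "m = a + b" "a \<in> Poly_Mapping.keys p" "b \<in> Poly_Mapping.keys q"
      using keys_mult[of p q] m by blast
    then show False
      using v that keys_add[of a b] by (fastforce simp: poly_ring_def)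
  qed
  show "abelian_group ?R"
  proof (rule abelian_groupI)
    fix p assume "p \<in> carrier ?R"
    then show "\<exists>q \<in> carrier ?R. q \<oplus>\<^bsub>?R\<^esub> p = \<zero>\<^bsub>?R\<^esub>"
      by (intro bexI[of _ "- p"]) (auto simp: poly_ring_def Poly_Mapping.in_keys_iff)
  qed (erule (1) add, simp_all add: poly_ring_def add.assoc add.commute)
  show "Group.comm_monoid ?R"
    by (rule comm_monoidI) (erule (1) mult, simp_all add: poly_ring_def ac_simps)
qed (simp add: poly_ring_def distrib_right)


section \<open>Square-free monomial ideals and their minors\<close>

text \<open>The zero ideal and the whole ring are square-free monomial ideals.\<close>

definition squarefree_monomial_ideal :: "nat set \<Rightarrow> 'k::field mvpoly set \<Rightarrow> bool" where
  "squarefree_monomial_ideal V I \<longleftrightarrow>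
     (\<exists>S. (\<forall>m \<in> S. Poly_Mapping.keys m \<subseteq> V \<and> (\<forall>v. Poly_Mapping.lookup m v \<le> 1)) \<and>
          I = Idl\<^bsub>poly_ring V\<^esub> (mon ` S))"

text \<open>
  Divisibility of monomials is the pointwise order on exponents; the instance of \<open>\<le>\<close> on
  \<open>nat \<Rightarrow>\<^sub>0 nat\<close> is a total (lexicographic) order and is not what is wanted.
\<close>

definition mon_dvd :: "(nat \<Rightarrow>\<^sub>0 nat) \<Rightarrow> (nat \<Rightarrow>\<^sub>0 nat) \<Rightarrow> bool" where
  "mon_dvd m n \<longleftrightarrow> (\<forall>v. Poly_Mapping.lookup m v \<le> Poly_Mapping.lookup n v)"

definition minimal_generators :: "'k::field mvpoly set \<Rightarrow> 'k mvpoly set" where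
  "minimal_generators I = mon ` {m. mon m \<in> I \<and> (\<forall>n. mon n \<in> I \<and> mon_dvd n m \<longrightarrow> n = m)}"

text \<open>The substitution \<open>x\<^sub>v = c\<close>.\<close>

definition set_var :: "nat \<Rightarrow> 'k \<Rightarrow> 'k::field mvpoly \<Rightarrow> 'k mvpoly" where
  "set_var v c p =
     (\<Sum>m \<in> Poly_Mapping.keys p.
        Poly_Mapping.single (Poly_Mapping.update v 0 m)
          (Poly_Mapping.lookup p m * c ^ Poly_Mapping.lookup m v))"

definition deletion :: "nat set \<Rightarrow> nat \<Rightarrow> 'k::field mvpoly set \<Rightarrow> 'k mvpoly set" where
  "deletion V v I = Idl\<^bsub>poly_ring (V - {v})\<^esub> (set_var v 0 ` minimal_generators I)"

definition contraction :: "nat set \<Rightarrow> nat \<Rightarrow> 'k::field mvpoly set \<Rightarrow> 'k mvpoly set" where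
  "contraction V v I = Idl\<^bsub>poly_ring (V - {v})\<^esub> (set_var v 1 ` minimal_generators I)"

text \<open>An ideal is paired with the variable set of the polynomial ring in which it lives.\<close>

inductive minor_step :: "nat set \<times> 'k::field mvpoly set \<Rightarrow> nat set \<times> 'k mvpoly set \<Rightarrow> bool" where
  delete: "v \<in> V \<Longrightarrow> minor_step (V, I) (V - {v}, deletion V v I)"
| contract: "v \<in> V \<Longrightarrow> minor_step (V, I) (V - {v}, contraction V v I)"

definition proper_minor :: "nat set \<times> 'k::field mvpoly set \<Rightarrow> nat set \<times> 'k mvpoly set \<Rightarrow> bool" where
  "proper_minor = minor_step\<^sup>+\<^sup>+"

text \<open>
  The theorem on \<open>\<mm> \<in> Ass(R/I\<^sup>t)\<close> needs the hypothesis \<open>I \<noteq> \<mm> \<or> s < t\<close>: the ideal \<open>I = \<mm>\<close> has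
  only normally torsion-free proper minors, and \<open>\<mm>\<close> is associated to \<open>R/\<mm>\<^sup>t\<close> for \<open>t \<ge> 1\<close>,
  but \<open>\<mm>\<^sup>t : y\<^sub>1\<cdots>y\<^sub>s\<close> is the whole ring once \<open>s \<ge> t\<close>, so that its quotient has no associated primes.
\<close>

end

theory Submission
  imports Defs
begin

text \<open>
  Since powers of \<open>I\<close> are monomial ideals, \<open>\<mm>\<close> is associated to \<open>R / I\<^sup>t\<close> iff there is a socle
  monomial: some \<open>a \<notin> I\<^sup>t\<close> with \<open>x\<^sub>v a \<in> I\<^sup>t\<close> for all \<open>v\<close>. If every variable divides \<open>a\<close>, then
  \<open>a = c y\<^sub>1\<cdots>y\<^sub>s\<close> and \<open>\<mm> = (I\<^sup>t : y\<^sub>1\<cdots>y\<^sub>s) : c\<close>.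

  If \<open>x\<^sub>v\<close> does not divide \<open>a\<close>, then \<open>a\<close> is also a socle monomial of the \<open>t\<close>-th power of the
  deletion of \<open>x\<^sub>v\<close>. This deletion is square-free and normally torsion-free, hence it is the ideal
  generated by all the other variables. So either \<open>x\<^sub>v \<in> I\<close> and \<open>I = \<mm>\<close>, or \<open>I\<close> is generated
  by the other variables; then \<open>x\<^sub>v a \<in> I\<^sup>t\<close> implies \<open>a \<in> I\<^sup>t\<close>, a contradiction. For \<open>I = \<mm>\<close> the
  monomials of degree \<open>t - 1\<close> are socle monomials, and one of them is divisible by
  \<open>y\<^sub>1\<cdots>y\<^sub>s\<close> because \<open>s < t\<close>.
\<close>

text \<open>Unit vectors are written \<open>Poly_Mapping.single v 1\<close>; with this rule off, the
  simplifier leaves the exponent 1 as it is.\<close>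

declare One_nat_def [simp del]

subsection \<open>Ideals and colon ideals\<close>

text \<open>Commutativity makes absorption from one side enough, and additive inverses come for free
  as products with the inverse of \<open>\<one>\<close>.\<close>

lemma (in cring) idealI_cring:
  assumes "J \<subseteq> carrier R" "\<zero> \<in> J" "\<And>a b. a \<in> J \<Longrightarrow> b \<in> J \<Longrightarrow> a \<oplus> b \<in> J"
    and mult: "\<And>a x. a \<in> J \<Longrightarrow> x \<in> carrier R \<Longrightarrow> x \<otimes> a \<in> J"
  shows "ideal J R"
proof (rule idealI)
  show "subgroup J (add_monoid R)"
  proof (rule add.subgroupI)
    fix a assume a: "a \<in> J"
    then have "\<ominus> a = (\<ominus> \<one>) \<otimes> a"
      using assms(1) by (auto simp: l_minus)
    then show "\<ominus> a \<in> J"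
      using mult[OF a] by simp
  qed (use assms in auto)
  fix a x assume a: "a \<in> J" "x \<in> carrier R"
  then have "a \<otimes> x = x \<otimes> a"
    using assms(1) by (auto intro: m_comm)
  with mult[OF a] show "x \<otimes> a \<in> J" "a \<otimes> x \<in> J"
    by auto
qed (rule ring_axioms)

lemma (in cring) ideal_colon:
  assumes "ideal J R" "f \<in> carrier R"
  shows "ideal (colon R J f) R"
proof -
  interpret J: ideal J R by fact
  show ?thesis
    by (rule idealI_cring) (use assms(2) J.I_l_closed in \<open>auto simp: colon_def l_distr m_assoc\<close>)
qed

lemma (in cring) colon_colon:
  assumes "f \<in> carrier R" "g \<in> carrier R"
  shows "colon R (colon R J f) g = colon R J (g \<otimes> f)"
  using assms by (auto simp: colon_def m_assoc)

text \<open>As \<open>(J : f) : g\<close> equals \<open>J : (g f)\<close>, a witness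
  \<open>g\<close> over \<open>J : f\<close> becomes the witness \<open>g f\<close> over
  \<open>J\<close>. This is the passage from the colon ideal back to the power.\<close>

lemma (in cring) Ass_quot_colon_subset:
  assumes "ideal J R" "f \<in> carrier R"
  shows "Ass R (quot_module R (colon R J f)) \<subseteq> Ass R (quot_module R J)"
  using assms ideal_colon[OF assms]
  by (force simp: Ass_quot_module[OF is_cring] colon_colon)


subsection \<open>Monomials\<close>

lemma mon_dvd_refl [simp]: "mon_dvd m m"
  by (simp add: mon_dvd_def)

lemma mon_dvd_zero [simp]: "mon_dvd 0 m"
  by (simp add: mon_dvd_def)

lemma mon_dvd_trans: "mon_dvd a b \<Longrightarrow> mon_dvd b c \<Longrightarrow> mon_dvd a c"
  by (meson mon_dvd_def le_trans)

lemma mon_dvd_add: "mon_dvd a b \<Longrightarrow> mon_dvd c d \<Longrightarrow> mon_dvd (a + c) (b + d)"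
  by (simp add: mon_dvd_def lookup_add add_mono)

lemma mon_dvd_add_left: "mon_dvd a b \<Longrightarrow> mon_dvd a (c + b)"
  by (simp add: mon_dvd_def lookup_add trans_le_add2)

lemma keys_mon_dvd: "mon_dvd a b \<Longrightarrow> Poly_Mapping.keys a \<subseteq> Poly_Mapping.keys b"
  unfolding mon_dvd_def in_keys_iff subset_iff by (metis le_zero_eq)

lemma keys_add_nat:
  "Poly_Mapping.keys (a + b :: nat \<Rightarrow>\<^sub>0 nat) = Poly_Mapping.keys a \<union> Poly_Mapping.keys b"
  by (auto simp: in_keys_iff lookup_add)

lemma mon_dvd_eq_add:
  assumes "mon_dvd a b"
  obtains c where "b = c + a"
proof
  show "b = (b - a) + a"
    using assms by (intro poly_mapping_eqI) (simp add: lookup_add lookup_minus mon_dvd_def)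
qed

lemma single_mon_dvd_iff: "mon_dvd (Poly_Mapping.single v 1) m \<longleftrightarrow> v \<in> Poly_Mapping.keys m"
  by (auto simp: mon_dvd_def lookup_single when_def in_keys_iff)

lemma mon_dvd_add_single_iff:
  assumes "Poly_Mapping.lookup s v = 0"
  shows "mon_dvd s (a + Poly_Mapping.single v n) \<longleftrightarrow> mon_dvd s a"
  unfolding mon_dvd_def lookup_add lookup_single
  by (metis add_0_right assms le0 when_simps(2))

lemma mon_mult: "mon a * mon b = mon (a + b)"
  by (simp add: mon_def mult_single)

lemma mon_zero: "mon 0 = 1"
  by (simp add: mon_def)

lemma keys_mon [simp]: "Poly_Mapping.keys (mon m :: 'k::field mvpoly) = {m}"
  by (simp add: mon_def)

text \<open>Multiplication by a monomial shifts the support: by cancellation,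
  \<open>m + a = l + a\<close> forces \<open>l = m\<close>, so one summand of the convolution
  survives.\<close>

lemma lookup_mult_mon:
  "Poly_Mapping.lookup (p * mon a :: 'k::field mvpoly) (m + a) = Poly_Mapping.lookup p m"
proof -
  have "(\<Sum>q. Poly_Mapping.lookup (mon a) q when m + a = l + q) = (1 when m = l :: 'k)" for l
  proof -
    have "(Poly_Mapping.lookup (mon a) q when m + a = l + q) = ((1 when m = l) when a = q :: 'k)" for q
      by (auto simp: mon_def lookup_single when_def)
    then show ?thesis
      by simp
  qed
  then show ?thesis
    by (simp add: lookup_mult mult_when)
qed

text \<open>Natural exponents add up to 0 only if both are 0. That the constant coefficient is
  multiplicative is what makes \<open>\<mm>\<close> prime.\<close>

lemma lookup_mult_zero:
  "Poly_Mapping.lookup (p * q :: 'k::field mvpoly) 0 = Poly_Mapping.lookup p 0 * Poly_Mapping.lookup q 0"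
proof -
  have "(\<Sum>n. Poly_Mapping.lookup q n when 0 = l + n) = (Poly_Mapping.lookup q 0 when l = 0)"
    for l :: "nat \<Rightarrow>\<^sub>0 nat"
  proof -
    have "0 = l + n \<longleftrightarrow> l = 0 \<and> n = 0" for n
      by (metis add.right_neutral keys_add_nat keys_eq_empty Un_empty)
    then have "(Poly_Mapping.lookup q n when 0 = l + n) = ((Poly_Mapping.lookup q 0 when l = 0) when n = 0)" for n
      by (auto simp: when_def)
    then show ?thesis
      by simp
  qed
  then show ?thesis
    by (simp add: lookup_mult mult_when)
qed

lemma poly_eq_sum_terms:
  "p = (\<Sum>m \<in> Poly_Mapping.keys p. Poly_Mapping.single 0 (Poly_Mapping.lookup p m) * mon m :: 'k::field mvpoly)"
  by (rule poly_mapping_eqI)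
    (auto simp: mon_def mult_single lookup_sum lookup_single when_def in_keys_iff)


subsection \<open>Monomial ideals\<close>

abbreviation monomials :: "nat set \<Rightarrow> (nat \<Rightarrow>\<^sub>0 nat) set" where
  "monomials V \<equiv> {m. Poly_Mapping.keys m \<subseteq> V}"

definition multiple_of :: "(nat \<Rightarrow>\<^sub>0 nat) set \<Rightarrow> (nat \<Rightarrow>\<^sub>0 nat) \<Rightarrow> bool" where
  "multiple_of S m \<longleftrightarrow> (\<exists>s \<in> S. mon_dvd s m)"

text \<open>Membership is tested term by term on the support, which turns questions about ideals
  into divisibility of exponents. \<open>genideal_mon\<close> identifies this set with the generated
  ideal when \<open>S\<close> consists of monomials in \<open>V\<close>.\<close>

definition monomial_ideal :: "nat set \<Rightarrow> (nat \<Rightarrow>\<^sub>0 nat) set \<Rightarrow> 'k::field mvpoly set" where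
  "monomial_ideal V S = {p \<in> carrier (poly_ring V). \<forall>m \<in> Poly_Mapping.keys p. multiple_of S m}"

lemma multiple_of_self: "s \<in> S \<Longrightarrow> multiple_of S s"
  unfolding multiple_of_def using mon_dvd_refl by blast

lemma multiple_of_add: "multiple_of S b \<Longrightarrow> multiple_of S (a + b)"
  unfolding multiple_of_def using mon_dvd_add_left by blast

lemma multiple_of_mono: "multiple_of S m \<Longrightarrow> S \<subseteq> T \<Longrightarrow> multiple_of T m"
  unfolding multiple_of_def by blast

lemma carrier_poly_ring:
  "p \<in> carrier (poly_ring V) \<longleftrightarrow> (\<forall>m \<in> Poly_Mapping.keys p. m \<in> monomials V)"
  by (simp add: poly_ring_def)

lemma poly_ring_simps [simp]:
  "mult (poly_ring V) = (*)" "one (poly_ring V) = 1" "zero (poly_ring V) = 0" "add (poly_ring V) = (+)"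
  by (simp_all add: poly_ring_def)

lemma mon_in_carrier_iff [simp]:
  "mon m \<in> carrier (poly_ring V :: 'k::field mvpoly ring) \<longleftrightarrow> m \<in> monomials V"
  by (simp add: carrier_poly_ring)

lemma const_in_carrier: "Poly_Mapping.single 0 c \<in> carrier (poly_ring V)"
  by (simp add: carrier_poly_ring)

lemma mon_in_monomial_ideal_iff:
  "mon m \<in> (monomial_ideal V S :: 'k::field mvpoly set) \<longleftrightarrow> m \<in> monomials V \<and> multiple_of S m"
  by (simp add: monomial_ideal_def)

lemma ideal_monomial_ideal: "ideal (monomial_ideal V S) (poly_ring V :: 'k::field mvpoly ring)"
proof -
  interpret R: cring "poly_ring V :: 'k mvpoly ring"
    by (rule cring_poly_ring)
  show ?thesis
  proof (rule R.idealI_cring)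
    fix p q :: "'k mvpoly" assume "p \<in> monomial_ideal V S" "q \<in> monomial_ideal V S"
    then show "p \<oplus>\<^bsub>poly_ring V\<^esub> q \<in> monomial_ideal V S"
      using keys_add[of p q] R.a_closed[of p q] by (auto simp: monomial_ideal_def)
  next
    fix p q :: "'k mvpoly" assume pq: "p \<in> monomial_ideal V S" "q \<in> carrier (poly_ring V)"
    have "multiple_of S m" if "m \<in> Poly_Mapping.keys (q * p)" for m
      using keys_mult[of q p] that pq multiple_of_add by (fastforce simp: monomial_ideal_def)
    with pq show "q \<otimes>\<^bsub>poly_ring V\<^esub> p \<in> monomial_ideal V S"
      using R.m_closed[of q p] by (auto simp: monomial_ideal_def)
  qed (auto simp: monomial_ideal_def carrier_poly_ring)
qed

lemma genideal_mon:
  assumes "S \<subseteq> monomials V"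
  shows "Idl\<^bsub>poly_ring V\<^esub> (mon ` S) = (monomial_ideal V S :: 'k::field mvpoly set)"
proof -
  interpret R: cring "poly_ring V :: 'k mvpoly ring"
    by (rule cring_poly_ring)
  let ?J = "Idl\<^bsub>poly_ring V\<^esub> (mon ` S :: 'k mvpoly set)"
  have S: "mon ` S \<subseteq> carrier (poly_ring V :: 'k mvpoly ring)"
    using assms by auto
  interpret J: ideal ?J "poly_ring V"
    by (rule R.genideal_ideal[OF S])
  show ?thesis
  proof (rule subset_antisym)
    show "?J \<subseteq> monomial_ideal V S"
      using assms by (intro R.genideal_minimal ideal_monomial_ideal)
        (force simp: mon_in_monomial_ideal_iff multiple_of_def)
    show "monomial_ideal V S \<subseteq> ?J"
    proof
      fix p :: "'k mvpoly" assume p: "p \<in> monomial_ideal V S"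
      have mon: "mon m \<in> ?J" if m: "m \<in> Poly_Mapping.keys p" for m
      proof -
        obtain s where "s \<in> S" "mon_dvd s m"
          using p m by (auto simp: monomial_ideal_def multiple_of_def)
        then obtain c where s: "s \<in> S" "m = c + s"
          by (metis mon_dvd_eq_add)
        moreover have "m \<in> monomials V"
          using p m by (simp add: monomial_ideal_def carrier_poly_ring)
        ultimately have "mon s \<in> ?J" "c \<in> monomials V"
          using R.genideal_self[OF S] by (auto simp: keys_add_nat)
        then show ?thesis
          using J.I_l_closed[of "mon s" "mon c"] s by (simp add: mon_mult)
      qed
      \<comment> \<open>Induction over subsets of the support: \<open>p\<close> is the sum of its
        terms, each a constant times a monomial already known to lie in \<open>?J\<close>.\<close>
      have "(\<Sum>m \<in> A. Poly_Mapping.single 0 (Poly_Mapping.lookup p m) * mon m) \<in> ?J"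
        if "A \<subseteq> Poly_Mapping.keys p" for A
        using finite_subset[OF that finite_keys] that
      proof (induction A rule: finite_induct)
        case empty
        then show ?case
          using J.zero_closed by simp
      next
        case (insert m A)
        then show ?case
          using J.I_l_closed[OF mon const_in_carrier, of m] J.a_closed by simp
      qed
      from this[OF subset_refl] show "p \<in> ?J"
        by (simp only: poly_eq_sum_terms[of p, symmetric])
    qed
  qed
qed

text \<open>The monomials \<open>mon m\<close> are the test elements in one direction; in the other,
  membership looks only at the support.\<close>

lemma monomial_ideal_eq_iff:
  assumes "S \<subseteq> monomials V" "T \<subseteq> monomials V"
  shows "monomial_ideal V S = (monomial_ideal V T :: 'k::field mvpoly set) \<longleftrightarrow>
         (\<forall>m \<in> monomials V. multiple_of S m \<longleftrightarrow> multiple_of T m)"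
proof
  assume eq: "monomial_ideal V S = (monomial_ideal V T :: 'k mvpoly set)"
  show "\<forall>m \<in> monomials V. multiple_of S m \<longleftrightarrow> multiple_of T m"
  proof
    fix m assume "m \<in> monomials V"
    then show "multiple_of S m \<longleftrightarrow> multiple_of T m"
      using mon_in_monomial_ideal_iff[of m V S, where 'k = 'k]
        mon_in_monomial_ideal_iff[of m V T, where 'k = 'k] by (simp add: eq)
  qed
qed (auto simp: monomial_ideal_def carrier_poly_ring)

text \<open>The \<open>t\<close>-fold sumset, repetition allowed: the exponents of products of
  \<open>t\<close> generators.\<close>

fun mon_power :: "(nat \<Rightarrow>\<^sub>0 nat) set \<Rightarrow> nat \<Rightarrow> (nat \<Rightarrow>\<^sub>0 nat) set" where
  "mon_power S 0 = {0}"
| "mon_power S (Suc t) = {a + b | a b. a \<in> mon_power S t \<and> b \<in> S}"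

lemma mon_power_monomials: "S \<subseteq> monomials V \<Longrightarrow> mon_power S t \<subseteq> monomials V"
  by (induction t) (auto simp: keys_add_nat subset_iff)

lemma mon_power_mono: "S \<subseteq> T \<Longrightarrow> mon_power S t \<subseteq> mon_power T t"
proof (induction t)
  case (Suc t)
  then show ?case
    by (simp add: subset_iff) blast
qed simp

text \<open>Every term of \<open>p * q\<close> has as exponent the sum of an exponent of
  \<open>p\<close> and one of \<open>q\<close>; conversely each generator \<open>mon (a + b)\<close>
  is itself a product \<open>mon a * mon b\<close>.\<close>

lemma monomial_ideal_prod:
  assumes S: "S \<subseteq> monomials V" and T: "T \<subseteq> monomials V"
  shows "ideal_prod (poly_ring V) (monomial_ideal V S) (monomial_ideal V T) =
         (monomial_ideal V {a + b | a b. a \<in> S \<and> b \<in> T} :: 'k::field mvpoly set)"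
    (is "?P = monomial_ideal V ?U")
proof (rule subset_antisym)
  interpret R: cring "poly_ring V :: 'k mvpoly ring"
    by (rule cring_poly_ring)
  interpret U: ideal "monomial_ideal V ?U :: 'k mvpoly set" "poly_ring V"
    by (rule ideal_monomial_ideal)
  show "?P \<subseteq> monomial_ideal V ?U"
  proof
    fix p assume "p \<in> ?P"
    then show "p \<in> monomial_ideal V ?U"
    proof (induction rule: ideal_prod.induct)
      case (prod p q)
      have "multiple_of ?U m" if m: "m \<in> Poly_Mapping.keys (p * q)" for m
      proof -
        obtain a b where "m = a + b" "a \<in> Poly_Mapping.keys p" "b \<in> Poly_Mapping.keys q"
          using keys_mult[of p q] m by blast
        moreover from this have "multiple_of S a" "multiple_of T b"
          using prod unfolding monomial_ideal_def by blast+
        then obtain a' b' where "a' \<in> S" "mon_dvd a' a" "b' \<in> T" "mon_dvd b' b"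
          unfolding multiple_of_def by blast
        ultimately have "a' \<in> S" "b' \<in> T" "mon_dvd (a' + b') m"
          by (simp_all add: mon_dvd_add)
        then show ?thesis
          unfolding multiple_of_def by blast
      qed
      moreover have "p * q \<in> carrier (poly_ring V)"
        using prod R.m_closed[of p q] unfolding monomial_ideal_def poly_ring_simps by blast
      ultimately show ?case
        unfolding monomial_ideal_def by simp
    qed (rule U.a_closed)
  qed
  have sub: "mon ` ?U \<subseteq> ?P"
  proof clarify
    fix a b assume ab: "a \<in> S" "b \<in> T"
    then have "mon a \<in> (monomial_ideal V S :: 'k mvpoly set)" "mon b \<in> (monomial_ideal V T :: 'k mvpoly set)"
      unfolding mon_in_monomial_ideal_iff using S T multiple_of_self by blast+
    from ideal_prod.prod[OF this, of "poly_ring V"] show "mon (a + b) \<in> ?P"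
      by (simp add: mon_mult)
  qed
  have U: "?U \<subseteq> monomials V"
  proof clarify
    fix a b v assume ab: "a \<in> S" "b \<in> T" "v \<in> Poly_Mapping.keys (a + b)"
    with S T have "a \<in> monomials V" "b \<in> monomials V"
      by blast+
    with ab(3) show "v \<in> V"
      by (auto simp: keys_add_nat)
  qed
  have "Idl\<^bsub>poly_ring V\<^esub> (mon ` ?U) = (monomial_ideal V ?U :: 'k mvpoly set)"
    using U by (rule genideal_mon)
  then show "monomial_ideal V ?U \<subseteq> ?P"
    using R.genideal_minimal[OF R.ideal_prod_is_ideal[OF ideal_monomial_ideal ideal_monomial_ideal] sub]
    by simp
qed

lemma ideal_power_monomial_ideal:
  assumes "S \<subseteq> monomials V"
  shows "ideal_power (poly_ring V) (monomial_ideal V S) t =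
         (monomial_ideal V (mon_power S t) :: 'k::field mvpoly set)"
proof (induction t)
  case 0
  \<comment> \<open>The zeroth power is the whole ring, and the exponent 0 divides every
    monomial.\<close>
  show ?case
    by (auto simp: ideal_power_def nat_pow_def ideals_set_def monomial_ideal_def multiple_of_def)
next
  case (Suc t)
  have "ideal_power (poly_ring V) (monomial_ideal V S :: 'k mvpoly set) (Suc t) =
      ideal_prod (poly_ring V) (ideal_power (poly_ring V) (monomial_ideal V S) t) (monomial_ideal V S)"
    by (simp add: ideal_power_def nat_pow_def ideals_set_def)
  then show ?case
    using Suc monomial_ideal_prod[OF mon_power_monomials[OF assms] assms] by simp
qed


subsection \<open>The maximal homogeneous ideal\<close>

abbreviation unit_vectors :: "nat set \<Rightarrow> (nat \<Rightarrow>\<^sub>0 nat) set" where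
  "unit_vectors V \<equiv> (\<lambda>v. Poly_Mapping.single v 1) ` V"

lemma multiple_of_unit_vectors_iff:
  "multiple_of (unit_vectors V) m \<longleftrightarrow> Poly_Mapping.keys m \<inter> V \<noteq> {}"
  by (auto simp: multiple_of_def single_mon_dvd_iff)

lemma maximal_homogeneous_ideal_eq:
  "maximal_homogeneous_ideal V = (monomial_ideal V (unit_vectors V) :: 'k::field mvpoly set)"
proof -
  have "var ` V = (mon ` unit_vectors V :: 'k mvpoly set)"
    by (simp add: var_def image_image)
  then show ?thesis
    unfolding maximal_homogeneous_ideal_def by (simp add: genideal_mon image_subset_iff)
qed

text \<open>A monomial in \<open>V\<close> other than 1 is divisible by some variable, so only the
  constant term can obstruct membership.\<close>

lemma in_maximal_homogeneous_ideal_iff: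
  "p \<in> (maximal_homogeneous_ideal V :: 'k::field mvpoly set) \<longleftrightarrow>
   p \<in> carrier (poly_ring V) \<and> Poly_Mapping.lookup p 0 = 0"
proof -
  have "multiple_of (unit_vectors V) m \<longleftrightarrow> m \<noteq> 0"
    if "p \<in> carrier (poly_ring V)" "m \<in> Poly_Mapping.keys p" for m
    using that by (auto simp: multiple_of_unit_vectors_iff carrier_poly_ring Int_absorb2)
  then show ?thesis
    by (auto simp: maximal_homogeneous_ideal_eq monomial_ideal_def simp flip: not_in_keys_iff_lookup_eq_zero)
qed

lemma primeideal_maximal_homogeneous_ideal:
  "primeideal (maximal_homogeneous_ideal V) (poly_ring V :: 'k::field mvpoly ring)"
proof (rule primeidealI)
  show "carrier (poly_ring V) \<noteq> (maximal_homogeneous_ideal V :: 'k mvpoly set)"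
    using in_maximal_homogeneous_ideal_iff[of "1 :: 'k mvpoly"]
    by (metis cring.cring_simprules(6) cring_poly_ring lookup_one_zero poly_ring_simps(2) zero_neq_one)
  show "ideal (maximal_homogeneous_ideal V :: 'k mvpoly set) (poly_ring V)"
    by (simp add: maximal_homogeneous_ideal_eq ideal_monomial_ideal)
qed (auto simp: in_maximal_homogeneous_ideal_iff lookup_mult_zero cring_poly_ring)

text \<open>For \<open>J = monomial_ideal V T\<close>, these are the exponents of the monomials with
  nonzero class in the socle of \<open>R / J\<close>.\<close>

definition socle :: "nat set \<Rightarrow> (nat \<Rightarrow>\<^sub>0 nat) set \<Rightarrow> (nat \<Rightarrow>\<^sub>0 nat) set" where
  "socle V T = {a \<in> monomials V. \<not> multiple_of T a \<and>
     (\<forall>v \<in> V. multiple_of T (a + Poly_Mapping.single v 1))}"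

text \<open>A monomial other than 1 contains a variable and so carries \<open>mon a\<close> into the
  ideal. The coefficient of \<open>p * mon a\<close> at \<open>a\<close> is the constant term of
  \<open>p\<close>, which must vanish because \<open>a\<close> is not in the ideal.\<close>

lemma colon_socle:
  assumes "a \<in> socle V T"
  shows "colon (poly_ring V) (monomial_ideal V T) (mon a) =
         (maximal_homogeneous_ideal V :: 'k::field mvpoly set)"
proof (rule Set.set_eqI)
  interpret R: cring "poly_ring V :: 'k mvpoly ring"
    by (rule cring_poly_ring)
  fix p :: "'k mvpoly"
  have a: "a \<in> monomials V" "\<not> multiple_of T a"
    using assms by (auto simp: socle_def)
  have up: "multiple_of T (b + a)" if b: "b \<in> monomials V" "b \<noteq> 0" for b
  proof -
    obtain v where v: "v \<in> Poly_Mapping.keys b"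
      using b(2) by fastforce
    then obtain c where "b = c + Poly_Mapping.single v 1"
      by (metis mon_dvd_eq_add single_mon_dvd_iff)
    then have "b + a = c + (a + Poly_Mapping.single v 1)"
      by (simp add: ac_simps)
    then show ?thesis
      using assms v b(1) multiple_of_add by (auto simp: socle_def)
  qed
  show "p \<in> colon (poly_ring V) (monomial_ideal V T) (mon a) \<longleftrightarrow> p \<in> maximal_homogeneous_ideal V"
  proof
    assume p: "p \<in> colon (poly_ring V) (monomial_ideal V T) (mon a)"
    then have "Poly_Mapping.lookup (p * mon a) (0 + a) = 0"
      using a by (auto simp: colon_def monomial_ideal_def in_keys_iff)
    then show "p \<in> maximal_homogeneous_ideal V"
      unfolding lookup_mult_mon using p by (simp add: in_maximal_homogeneous_ideal_iff colon_def)
  next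
    assume p: "p \<in> maximal_homogeneous_ideal V"
    then have "multiple_of T m" if m: "m \<in> Poly_Mapping.keys (p * mon a)" for m
    proof -
      obtain b where "m = b + a" "b \<in> Poly_Mapping.keys p"
        using m keys_mult[of p "mon a"] by auto
      then show ?thesis
        using up[of b] p
        by (auto simp: in_maximal_homogeneous_ideal_iff carrier_poly_ring in_keys_iff)
    qed
    then show "p \<in> colon (poly_ring V) (monomial_ideal V T) (mon a)"
      using p a R.m_closed[of p "mon a"]
      by (simp add: in_maximal_homogeneous_ideal_iff colon_def monomial_ideal_def)
  qed
qed

text \<open>If \<open>\<mm> = J : f\<close>, then \<open>f\<close> has a term \<open>a\<close>
  outside \<open>J\<close>. Multiplying by a variable shifts the support of \<open>f\<close>, and a
  monomial ideal contains the monomials of its members, so this \<open>a\<close> is a socle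
  monomial.\<close>

lemma maximal_homogeneous_ideal_in_Ass_iff:
  "maximal_homogeneous_ideal V \<in> Ass (poly_ring V) (quot_module (poly_ring V) (monomial_ideal V T))
   \<longleftrightarrow> socle V T \<noteq> {}" (is "?\<mm> \<in> Ass ?R (quot_module ?R ?J) \<longleftrightarrow> _" is "?l \<longleftrightarrow> _")
proof
  assume ?l
  then obtain f where f: "f \<in> carrier ?R" "?\<mm> = colon ?R ?J f"
    by (auto simp: Ass_quot_module[OF cring_poly_ring ideal_monomial_ideal])
  have "1 \<notin> ?\<mm>"
    by (simp add: in_maximal_homogeneous_ideal_iff)
  then have "f \<notin> ?J"
    using f cring.cring_simprules(6)[OF cring_poly_ring, of V] by (auto simp: colon_def)
  then obtain a where a: "a \<in> Poly_Mapping.keys f" "\<not> multiple_of T a"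
    using f by (auto simp: monomial_ideal_def)
  have "multiple_of T (a + Poly_Mapping.single v 1)" if "v \<in> V" for v
  proof -
    have "mon (Poly_Mapping.single v 1) \<in> ?\<mm>"
      using that by (simp add: maximal_homogeneous_ideal_eq mon_in_monomial_ideal_iff multiple_of_unit_vectors_iff)
    then have "f * mon (Poly_Mapping.single v 1) \<in> ?J"
      using f by (simp add: colon_def mult.commute)
    moreover have "a + Poly_Mapping.single v 1 \<in> Poly_Mapping.keys (f * mon (Poly_Mapping.single v 1))"
      using a by (simp add: in_keys_iff lookup_mult_mon)
    ultimately show ?thesis
      by (simp add: monomial_ideal_def)
  qed
  then have "a \<in> socle V T"
    using a f(1) by (auto simp: socle_def carrier_poly_ring)
  then show "socle V T \<noteq> {}"
    by blast
next
  assume "socle V T \<noteq> {}"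
  then obtain a where a: "a \<in> socle V T"
    by blast
  then have "mon a \<in> carrier ?R"
    by (simp add: socle_def)
  then show ?l
    using colon_socle[OF a] primeideal_maximal_homogeneous_ideal
    by (fastforce simp: Ass_quot_module[OF cring_poly_ring ideal_monomial_ideal])
qed

text \<open>The witness is \<open>mon c\<close>, since \<open>(J : mon b) : mon c\<close> equals
  \<open>J : mon (c + b)\<close>.\<close>

lemma maximal_homogeneous_ideal_in_Ass_colon:
  assumes "c + b \<in> socle V T"
  shows "maximal_homogeneous_ideal V \<in> Ass (poly_ring V)
    (quot_module (poly_ring V) (colon (poly_ring V) (monomial_ideal V T) (mon b :: 'k::field mvpoly)))"
proof -
  interpret R: cring "poly_ring V :: 'k mvpoly ring"
    by (rule cring_poly_ring)
  have bc: "mon b \<in> carrier (poly_ring V :: 'k mvpoly ring)" "mon c \<in> carrier (poly_ring V :: 'k mvpoly ring)"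
    using assms by (auto simp: socle_def keys_add_nat)
  then have "colon (poly_ring V) (colon (poly_ring V) (monomial_ideal V T) (mon b)) (mon c) =
      (maximal_homogeneous_ideal V :: 'k mvpoly set)"
    by (simp add: R.colon_colon mon_mult colon_socle[OF assms])
  with bc show ?thesis
    using primeideal_maximal_homogeneous_ideal
    by (fastforce simp: Ass_quot_module[OF cring_poly_ring R.ideal_colon] ideal_monomial_ideal)
qed


subsection \<open>Square-free monomial ideals\<close>

lemma multiple_of_minimal:
  assumes "multiple_of S m"
  obtains n where "mon_dvd n m" "multiple_of S n"
    "\<forall>n'. multiple_of S n' \<and> mon_dvd n' n \<longrightarrow> n' = n"
proof -
  \<comment> \<open>Summing over the support of \<open>m\<close> covers every divisor of
    \<open>m\<close>, so a divisor of \<open>n\<close> with the same degree agrees with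
    \<open>n\<close> in every exponent.\<close>
  define deg where "deg n = (\<Sum>v \<in> Poly_Mapping.keys m. Poly_Mapping.lookup n v)" for n :: "nat \<Rightarrow>\<^sub>0 nat"
  obtain n where n: "mon_dvd n m" "multiple_of S n"
    "\<And>n'. mon_dvd n' m \<and> multiple_of S n' \<Longrightarrow> deg n \<le> deg n'"
    using ex_has_least_nat[of "\<lambda>n. mon_dvd n m \<and> multiple_of S n" m deg] assms by auto
  have "n' = n" if n': "multiple_of S n'" "mon_dvd n' n" for n'
  proof (rule poly_mapping_eqI)
    fix v
    have le: "Poly_Mapping.lookup n' v \<le> Poly_Mapping.lookup n v" for v
      using n' by (simp add: mon_dvd_def)
    have "deg n' \<le> deg n"
      unfolding deg_def by (intro sum_mono le)
    moreover have "deg n \<le> deg n'"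
      using n(3) n' mon_dvd_trans[OF n'(2) n(1)] by simp
    ultimately have "deg n' = deg n"
      by simp
    then have "Poly_Mapping.lookup n' v = Poly_Mapping.lookup n v" if "v \<in> Poly_Mapping.keys m"
      using sum_mono_inv[OF _ le that] by (simp add: deg_def)
    then show "Poly_Mapping.lookup n' v = Poly_Mapping.lookup n v"
      using keys_mon_dvd[OF n(1)] le[of v]
      by (cases "v \<in> Poly_Mapping.keys n") (auto simp: not_in_keys_iff_lookup_eq_zero)
  qed
  with n(1,2) show thesis
    by (intro that[of n]) simp_all
qed

lemma set_var_zero_mon:
  "set_var v 0 (mon m :: 'k::field mvpoly) = (if v \<in> Poly_Mapping.keys m then 0 else mon m)"
proof (cases "v \<in> Poly_Mapping.keys m")
  case False
  then have "Poly_Mapping.update v 0 m = m"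
    by (intro poly_mapping_eqI) (auto simp: lookup_update in_keys_iff)
  with False show ?thesis
    by (simp add: set_var_def mon_def in_keys_iff)
qed (simp add: set_var_def in_keys_iff power_0_left)

text \<open>Deletion is defined through minimal generators, whereas \<open>S\<close> is any
  generating set. Divisors of a monomial free of \<open>v\<close> are free of \<open>v\<close>, so
  one may pass between the two kinds of generators below such a monomial.\<close>

lemma deletion_monomial_ideal:
  assumes S: "S \<subseteq> monomials V"
  shows "deletion V v (monomial_ideal V S) =
         (monomial_ideal (V - {v}) {s \<in> S. v \<notin> Poly_Mapping.keys s} :: 'k::field mvpoly set)"
proof -
  interpret R: cring "poly_ring (V - {v}) :: 'k mvpoly ring"
    by (rule cring_poly_ring)
  define M where "M = {m \<in> monomials V. multiple_of S m \<and>
      (\<forall>n \<in> monomials V. multiple_of S n \<and> mon_dvd n m \<longrightarrow> n = m)}"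
  define M' where "M' = {m \<in> M. v \<notin> Poly_Mapping.keys m}"
  have gen: "minimal_generators (monomial_ideal V S) = (mon ` M :: 'k mvpoly set)"
    unfolding minimal_generators_def M_def by (auto simp: mon_in_monomial_ideal_iff)
  have M': "M' \<subseteq> monomials (V - {v})" "{s \<in> S. v \<notin> Poly_Mapping.keys s} \<subseteq> monomials (V - {v})"
    using S by (auto simp: M'_def M_def)
  let ?G = "set_var v 0 ` (mon ` M :: 'k mvpoly set)"
  \<comment> \<open>Minimal generators divisible by the variable become 0 and the others stay fixed;
    the extra 0 does not change the generated ideal.\<close>
  have G: "mon ` M' \<subseteq> ?G" "?G \<subseteq> insert 0 (mon ` M')"
    by (auto simp: M'_def set_var_zero_mon image_iff split: if_splits)
  have M'c: "mon ` M' \<subseteq> carrier (poly_ring (V - {v}) :: 'k mvpoly ring)"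
    using M' by auto
  then have Gc: "?G \<subseteq> carrier (poly_ring (V - {v}))"
    using R.zero_closed by (intro subset_trans[OF G(2)]) simp
  have "deletion V v (monomial_ideal V S) = Idl\<^bsub>poly_ring (V - {v})\<^esub> ?G"
    by (simp add: deletion_def gen)
  also have "\<dots> = Idl\<^bsub>poly_ring (V - {v})\<^esub> (mon ` M')"
  proof (rule subset_antisym)
    show "Idl\<^bsub>poly_ring (V - {v})\<^esub> ?G \<subseteq> Idl\<^bsub>poly_ring (V - {v})\<^esub> (mon ` M')"
      using R.genideal_self[OF M'c]
        additive_subgroup.zero_closed[OF ideal.axioms(1)[OF R.genideal_ideal[OF M'c]]]
      by (intro R.genideal_minimal R.genideal_ideal M'c subset_trans[OF G(2)]) simp
    show "Idl\<^bsub>poly_ring (V - {v})\<^esub> (mon ` M') \<subseteq> Idl\<^bsub>poly_ring (V - {v})\<^esub> ?G"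
      using G(1) R.genideal_self[OF Gc] by (intro R.genideal_minimal R.genideal_ideal Gc) auto
  qed
  also have "\<dots> = monomial_ideal (V - {v}) M'"
    by (rule genideal_mon) fact
  also have "\<dots> = monomial_ideal (V - {v}) {s \<in> S. v \<notin> Poly_Mapping.keys s}"
    unfolding monomial_ideal_eq_iff[OF M']
  proof (intro ballI iffI)
    fix m assume m: "m \<in> monomials (V - {v})" "multiple_of M' m"
    then obtain n s where "n \<in> M'" "mon_dvd n m" "s \<in> S" "mon_dvd s n"
      by (auto simp: multiple_of_def M'_def M_def)
    moreover from this have "v \<notin> Poly_Mapping.keys s"
      using keys_mon_dvd[of s n] by (auto simp: M'_def)
    ultimately show "multiple_of {s \<in> S. v \<notin> Poly_Mapping.keys s} m"
      using mon_dvd_trans by (auto simp: multiple_of_def)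
  next
    fix m assume m: "m \<in> monomials (V - {v})" "multiple_of {s \<in> S. v \<notin> Poly_Mapping.keys s} m"
    then have "multiple_of S m"
      by (auto elim: multiple_of_mono)
    then obtain n where n: "mon_dvd n m" "multiple_of S n"
      "\<forall>n'. multiple_of S n' \<and> mon_dvd n' n \<longrightarrow> n' = n"
      by (metis multiple_of_minimal)
    then have "n \<in> M'"
      using keys_mon_dvd[OF n(1)] m(1) by (auto simp: M'_def M_def)
    with n(1) show "multiple_of M' m"
      by (auto simp: multiple_of_def)
  qed
  finally show ?thesis .
qed

text \<open>A product of generators is free of \<open>v\<close> only if each factor is.\<close>

lemma multiple_of_mon_power_without:
  assumes "multiple_of (mon_power S t) m" "v \<notin> Poly_Mapping.keys m"
  shows "multiple_of (mon_power {s \<in> S. v \<notin> Poly_Mapping.keys s} t) m"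
proof -
  have "r \<in> mon_power S t \<Longrightarrow> v \<notin> Poly_Mapping.keys r \<Longrightarrow>
      r \<in> mon_power {s \<in> S. v \<notin> Poly_Mapping.keys s} t" for r
  proof (induction t arbitrary: r)
    case (Suc t)
    then show ?case
      by (fastforce simp: keys_add_nat)
  qed simp
  then show ?thesis
    using assms keys_mon_dvd by (fastforce simp: multiple_of_def)
qed

text \<open>In a product of \<open>t\<close> elements of \<open>S\<close>, each factor can be
  replaced by a divisor from \<open>T\<close>.\<close>

lemma multiple_of_mon_power_refine:
  assumes "\<And>s. s \<in> S \<Longrightarrow> multiple_of T s" "multiple_of (mon_power S t) m"
  shows "multiple_of (mon_power T t) m"
proof -
  have "r \<in> mon_power S t \<Longrightarrow> multiple_of (mon_power T t) r" for r
  proof (induction t arbitrary: r)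
    case (Suc t)
    then obtain a b where ab: "r = a + b" "a \<in> mon_power S t" "b \<in> S"
      by auto
    then obtain a' b' where "a' \<in> mon_power T t" "mon_dvd a' a" "b' \<in> T" "mon_dvd b' b"
      using Suc.IH assms(1) by (force simp: multiple_of_def)
    then have "a' + b' \<in> mon_power T (Suc t)" "mon_dvd (a' + b') r"
      using ab(1) by (auto intro: mon_dvd_add)
    then show ?case
      unfolding multiple_of_def by blast
  qed (simp add: multiple_of_def)
  then show ?thesis
    using assms(2) mon_dvd_trans by (fastforce simp: multiple_of_def)
qed

definition squarefree_exponents :: "(nat \<Rightarrow>\<^sub>0 nat) set \<Rightarrow> bool" where
  "squarefree_exponents S \<longleftrightarrow> (\<forall>m \<in> S. \<forall>v. Poly_Mapping.lookup m v \<le> 1)"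

text \<open>If \<open>v\<close> occurs in \<open>b\<close>, a square-free generator dividing
  \<open>b\<close> times the variable \<open>v\<close> already divides \<open>b\<close>, as its
  exponent at \<open>v\<close> is at most 1.\<close>

lemma socle_squarefree:
  assumes "squarefree_exponents S" "b \<in> socle V S"
  shows "b = 0"
proof (rule ccontr)
  assume "b \<noteq> 0"
  then obtain v where v: "v \<in> Poly_Mapping.keys b"
    by fastforce
  then obtain s where s: "s \<in> S" "mon_dvd s (b + Poly_Mapping.single v 1)"
    using assms(2) unfolding socle_def multiple_of_def by blast
  have "Poly_Mapping.lookup s w \<le> Poly_Mapping.lookup b w" for w
  proof (cases "w = v")
    case True
    have "Poly_Mapping.lookup s v \<le> 1"
      using assms(1) s(1) by (simp add: squarefree_exponents_def)
    also have "1 \<le> Poly_Mapping.lookup b v"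
      using v by (simp add: in_keys_iff)
    finally show ?thesis
      using True by simp
  next
    case False
    with s(2) show ?thesis
      unfolding mon_dvd_def lookup_add by (metis add.right_neutral lookup_single_not_eq)
  qed
  then have "multiple_of S b"
    using s(1) by (auto simp: mon_dvd_def multiple_of_def)
  with assms(2) show False
    by (simp add: socle_def)
qed

text \<open>The case \<open>I = \<mm>\<close> has to be kept apart: with a second variable
  \<open>w\<close>, the power of \<open>w\<close> with exponent \<open>t - 1\<close> is a socle
  monomial of the \<open>t\<close>-th power of \<open>\<mm>\<close> that lacks
  \<open>v\<close>.\<close>

lemma socle_mon_power_full_support:
  fixes I :: "'k::field mvpoly set"
  assumes S: "S \<subseteq> monomials V" "squarefree_exponents S" and I: "I = monomial_ideal V S"
    and v: "v \<in> V" and a: "a \<in> socle V (mon_power S t)" and t: "t \<ge> 1"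
    and ntf: "normally_torsion_free (poly_ring (V - {v})) (deletion V v I)"
    and ne: "I \<noteq> maximal_homogeneous_ideal V"
  shows "v \<in> Poly_Mapping.keys a"
proof (rule ccontr)
  assume va: "v \<notin> Poly_Mapping.keys a"
  define S' where "S' = {s \<in> S. v \<notin> Poly_Mapping.keys s}"
  define V' where "V' = V - {v}"
  have S': "S' \<subseteq> monomials V'" "S' \<subseteq> S" "squarefree_exponents S'"
    using S by (auto simp: S'_def V'_def squarefree_exponents_def)
  have power: "multiple_of (mon_power S' t) m"
    if "multiple_of (mon_power S t) m" "v \<notin> Poly_Mapping.keys m" for m
    using multiple_of_mon_power_without that unfolding S'_def by blast
  have not_a: "\<not> multiple_of (mon_power S' t) a"
    using a multiple_of_mono[OF _ mon_power_mono[OF S'(2)]] by (auto simp: socle_def)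
  \<comment> \<open>For \<open>w\<close> other than \<open>v\<close>, the product of
    \<open>a\<close> with the variable \<open>w\<close> still avoids \<open>v\<close>, so the
    generators of the deletion suffice.\<close>
  have "a \<in> socle V' (mon_power S' t)"
    using a va not_a by (auto simp: socle_def V'_def keys_add_nat intro!: power)
  then have "maximal_homogeneous_ideal V' \<in> Ass (poly_ring V')
      (quot_module (poly_ring V') (ideal_power (poly_ring V') (monomial_ideal V' S' :: 'k mvpoly set) t))"
    using maximal_homogeneous_ideal_in_Ass_iff S'(1) by (auto simp: ideal_power_monomial_ideal)
  moreover have "deletion V v I = monomial_ideal V' S'"
    using deletion_monomial_ideal[OF S(1)] by (simp add: I V'_def S'_def)
  ultimately have "maximal_homogeneous_ideal V' \<in> Ass (poly_ring V')
      (quot_module (poly_ring V') (monomial_ideal V' S' :: 'k mvpoly set))"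
    using ntf t by (simp add: normally_torsion_free_def V'_def)
  \<comment> \<open>Normal torsion-freeness has moved the prime from the \<open>t\<close>-th power
    to the first, where the only possible socle monomial is 1. Hence the deletion contains every
    variable of \<open>V'\<close> but not 1.\<close>
  then have zero: "0 \<in> socle V' S'"
    using socle_squarefree[OF S'(3)] by (auto simp: maximal_homogeneous_ideal_in_Ass_iff)
  have vars: "Poly_Mapping.single w 1 \<in> S'" if w: "w \<in> V'" for w
  proof -
    have "multiple_of S' (Poly_Mapping.single w 1)" "\<not> multiple_of S' 0"
      using zero w by (auto simp: socle_def)
    then obtain s where s: "s \<in> S'" "mon_dvd s (Poly_Mapping.single w 1)" "s \<noteq> 0"
      unfolding multiple_of_def using mon_dvd_refl by blast
    then have "w \<in> Poly_Mapping.keys s"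
      using keys_mon_dvd[OF s(2)] by (auto simp: subset_singleton_iff)
    then obtain c where c: "s = c + Poly_Mapping.single w 1"
      by (metis mon_dvd_eq_add single_mon_dvd_iff)
    with s(2) have "c = 0"
      by (intro poly_mapping_eqI) (simp add: mon_dvd_def lookup_add)
    with c s(1) show ?thesis
      by simp
  qed
  \<comment> \<open>The exponent 0 avoids \<open>v\<close>, so it would survive in
    \<open>S'\<close>.\<close>
  have nz: "0 \<notin> S"
    using zero by (auto simp: socle_def multiple_of_def S'_def)
  show False
  proof (cases "Poly_Mapping.single v 1 \<in> S")
    case True
    have "multiple_of S m \<longleftrightarrow> multiple_of (unit_vectors V) m" if m: "m \<in> monomials V" for m
    proof
      assume "multiple_of S m"
      then have "m \<noteq> 0"
        using nz keys_mon_dvd unfolding multiple_of_def by fastforce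
      then show "multiple_of (unit_vectors V) m"
        using m by (auto simp: multiple_of_unit_vectors_iff Int_absorb2)
    next
      assume "multiple_of (unit_vectors V) m"
      moreover have "unit_vectors V \<subseteq> S"
        using True vars S'(2) by (auto simp: V'_def)
      ultimately show "multiple_of S m"
        by (rule multiple_of_mono)
    qed
    then have "I = maximal_homogeneous_ideal V"
      using S(1) unfolding I maximal_homogeneous_ideal_eq
      by (subst monomial_ideal_eq_iff) auto
    with ne show False ..
  next
    case False
    \<comment> \<open>A generator in which only \<open>v\<close> occurs would, being square-free, be
      the variable \<open>v\<close> itself, which this case excludes. So each generator contains a
      variable of \<open>V'\<close>.\<close>
    have refine: "multiple_of S' s" if s: "s \<in> S" for s
    proof -
      have "\<exists>w. w \<in> Poly_Mapping.keys s \<and> w \<noteq> v"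
      proof (rule ccontr)
        assume only: "\<not> ?thesis"
        moreover have "s \<noteq> 0"
          using s nz by blast
        then have "Poly_Mapping.keys s \<noteq> {}"
          by simp
        ultimately have "v \<in> Poly_Mapping.keys s"
          by blast
        then have "Poly_Mapping.lookup s v = 1"
          using s S(2) by (simp add: squarefree_exponents_def in_keys_iff le_antisym)
        with only have "s = Poly_Mapping.single v 1"
          by (intro poly_mapping_eqI) (auto simp: lookup_single when_def in_keys_iff)
        with s False show False
          by simp
      qed
      then obtain w where w: "w \<in> Poly_Mapping.keys s" "w \<noteq> v"
        by blast
      then have "w \<in> V'"
        using s S(1) by (auto simp: V'_def)
      with w(1) show ?thesis
        using vars single_mon_dvd_iff unfolding multiple_of_def by blast
    qed
    have "multiple_of (mon_power S t) (a + Poly_Mapping.single v 1)"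
      using a v by (simp add: socle_def)
    with refine have "multiple_of (mon_power S' t) (a + Poly_Mapping.single v 1)"
      by (rule multiple_of_mon_power_refine)
    then obtain r where r: "r \<in> mon_power S' t" "mon_dvd r (a + Poly_Mapping.single v 1)"
      by (auto simp: multiple_of_def)
    \<comment> \<open>As \<open>r\<close> does not involve \<open>v\<close>, the extra factor cannot
      help it divide: \<open>r\<close> already divides \<open>a\<close>.\<close>
    then have "v \<notin> Poly_Mapping.keys r"
      using mon_power_monomials[OF S'(1), of t] by (auto simp: V'_def)
    then have "mon_dvd r a"
      using r(2) mon_dvd_add_single_iff by (simp add: in_keys_iff)
    with r(1) not_a show False
      by (auto simp: multiple_of_def)
  qed
qed


subsection \<open>Powers of the maximal homogeneous ideal\<close>

definition total_degree :: "nat set \<Rightarrow> (nat \<Rightarrow>\<^sub>0 nat) \<Rightarrow> nat" where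
  "total_degree V m = (\<Sum>v \<in> V. Poly_Mapping.lookup m v)"

lemma total_degree_add: "total_degree V (a + b) = total_degree V a + total_degree V b"
  by (simp add: total_degree_def lookup_add sum.distrib)

lemma total_degree_single:
  "finite V \<Longrightarrow> v \<in> V \<Longrightarrow> total_degree V (Poly_Mapping.single v n) = n"
  by (simp add: total_degree_def lookup_single when_def)

text \<open>A monomial of positive degree contains a variable; splitting it off lowers the degree by
  one.\<close>

lemma mon_power_unit_vectors:
  assumes "finite V"
  shows "mon_power (unit_vectors V) t = {m \<in> monomials V. total_degree V m = t}"
proof (induction t)
  case 0
  have "m = 0" if "m \<in> monomials V" "total_degree V m = 0" for m
    using that assms by (intro poly_mapping_eqI) (auto simp: total_degree_def in_keys_iff subset_iff)
  then show ?case
    by (auto simp: total_degree_def)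
next
  case (Suc t)
  have "m \<in> mon_power (unit_vectors V) (Suc t)"
    if m: "m \<in> monomials V" "total_degree V m = Suc t" for m
  proof -
    obtain v where v: "v \<in> V" "v \<in> Poly_Mapping.keys m"
      using m(2) unfolding total_degree_def by (metis in_keys_iff nat.distinct(1) sum.neutral)
    then obtain c where c: "m = c + Poly_Mapping.single v 1"
      by (metis mon_dvd_eq_add single_mon_dvd_iff)
    then have "c \<in> mon_power (unit_vectors V) t"
      using m v(1) assms by (auto simp: Suc keys_add_nat total_degree_add total_degree_single)
    with c v(1) show ?thesis
      by auto
  qed
  moreover have "m \<in> monomials V \<and> total_degree V m = Suc t"
    if "m \<in> mon_power (unit_vectors V) (Suc t)" for m
    using that assms by (auto simp: Suc keys_add_nat total_degree_add total_degree_single)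
  ultimately show ?case
    by blast
qed

text \<open>Divisors of \<open>a\<close> have degree below \<open>t\<close>, while one more variable
  gives degree exactly \<open>t\<close>, hence a generator.\<close>

lemma socle_mon_power_unit_vectors:
  assumes V: "finite V" and a: "a \<in> monomials V" "Suc (total_degree V a) = t"
  shows "a \<in> socle V (mon_power (unit_vectors V) t)"
proof -
  have "\<not> mon_dvd r a" if "r \<in> mon_power (unit_vectors V) t" for r
  proof
    assume "mon_dvd r a"
    then have "total_degree V r \<le> total_degree V a"
      by (auto simp: total_degree_def mon_dvd_def intro: sum_mono)
    with that a(2) V show False
      by (simp add: mon_power_unit_vectors)
  qed
  moreover have "a + Poly_Mapping.single v 1 \<in> mon_power (unit_vectors V) t" if "v \<in> V" for v
    using that a V by (simp add: mon_power_unit_vectors keys_add_nat total_degree_add total_degree_single)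
  ultimately show ?thesis
    using a(1) unfolding socle_def multiple_of_def by (auto intro: mon_dvd_refl simp del: mon_power.simps)
qed

text \<open>For infinite \<open>A\<close> both sides take their default value 1, since the sum of
  exponents is then 0.\<close>

lemma prod_var: "(\<Prod>v \<in> A. var v) = (mon (\<Sum>v \<in> A. Poly_Mapping.single v 1) :: 'k::field mvpoly)"
  by (induction A rule: infinite_finite_induct) (simp_all add: mon_zero var_def mon_mult)

lemma lookup_sum_unit_vectors:
  "finite A \<Longrightarrow> Poly_Mapping.lookup (\<Sum>v \<in> A. Poly_Mapping.single v 1) w = (1 when w \<in> A)"
  by (simp add: lookup_sum lookup_single when_def)

theorem theorem3p5:
  fixes I :: "'k::field mvpoly set" and d s t :: nat and y :: "nat \<Rightarrow> nat"
  defines "R \<equiv> poly_ring {1..d}"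
    and "\<mm> \<equiv> maximal_homogeneous_ideal {1..d}"
  assumes "squarefree_monomial_ideal {1..d} I"
    and "\<And>W J. proper_minor ({1..d}, I) (W, J) \<Longrightarrow> normally_torsion_free (poly_ring W) J"
    and "inj_on y {1..s}" and "y ` {1..s} \<subseteq> {1..d}"
    and "t \<ge> 1"
    and "I \<noteq> \<mm> \<or> s < t"
  shows "\<mm> \<in> Ass R (quot_module R (ideal_power R I t)) \<longleftrightarrow>
         \<mm> \<in> Ass R (quot_module R (colon R (ideal_power R I t) (\<Prod>i = 1..s. var (y i))))"
proof -
  define V where "V = {1..d}"
  define Y where "Y = y ` {1..s}"
  define b where "b = (\<Sum>v \<in> Y. Poly_Mapping.single v (1::nat))"
  have Y: "finite V" "finite Y" "Y \<subseteq> V" "card Y = s"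
    using assms(5,6) by (auto simp: V_def Y_def card_image)
  have lookup_b: "Poly_Mapping.lookup b v = (1 when v \<in> Y)" for v
    using lookup_sum_unit_vectors[OF Y(2)] by (simp add: b_def)
  have keys_b: "Poly_Mapping.keys b = Y"
    by (auto simp: in_keys_iff lookup_b when_def split: if_splits)
  have deg_b: "total_degree V b = s"
    using Y by (simp add: total_degree_def lookup_b when_def sum.If_cases Int_absorb1)
  have prod: "(\<Prod>i = 1..s. var (y i)) = (mon b :: 'k mvpoly)"
    using prod.reindex[OF assms(5), of "var :: _ \<Rightarrow> 'k mvpoly"] prod_var[of Y, where 'k = 'k]
    by (simp add: b_def Y_def)
  obtain S where "\<forall>m \<in> S. Poly_Mapping.keys m \<subseteq> V \<and> (\<forall>v. Poly_Mapping.lookup m v \<le> 1)"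
      "I = Idl\<^bsub>poly_ring V\<^esub> (mon ` S)"
    using assms(3) by (auto simp: squarefree_monomial_ideal_def V_def)
  then have S: "S \<subseteq> monomials V" "squarefree_exponents S" and I: "I = monomial_ideal V S"
    using genideal_mon[of S V, where 'k = 'k] by (auto simp: squarefree_exponents_def subset_iff)
  have power: "ideal_power R I t = monomial_ideal V (mon_power S t)"
    using ideal_power_monomial_ideal[OF S(1)] by (simp add: R_def I V_def)
  show ?thesis
  proof
    assume "\<mm> \<in> Ass R (quot_module R (ideal_power R I t))"
    then obtain a where a: "a \<in> socle V (mon_power S t)"
      unfolding power unfolding R_def \<mm>_def V_def maximal_homogeneous_ideal_in_Ass_iff by blast
    \<comment> \<open>Both cases end in a socle monomial divisible by \<open>mon b\<close>. The
      generating set \<open>T\<close> is left open because \<open>I = \<mm>\<close> is handled with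
      the variables as generators instead of \<open>S\<close>.\<close>
    have "\<exists>c T. c + b \<in> socle V T \<and> ideal_power R I t = monomial_ideal V T"
    proof (cases "I = \<mm>")
      case False
      \<comment> \<open>A single deletion is already a proper minor, so the hypothesis on minors
        applies to it.\<close>
      have "v \<in> Poly_Mapping.keys a" if "v \<in> V" for v
        using socle_mon_power_full_support[OF S I that a assms(7)] False
          assms(4)[of "V - {v}" "deletion V v I"] minor_step.delete[OF that, of I]
        by (simp add: proper_minor_def V_def \<mm>_def tranclp.r_into_trancl)
      then have "mon_dvd b a"
        using Y(3) by (auto simp: mon_dvd_def lookup_b when_def in_keys_iff Suc_le_eq One_nat_def)
      with a power show ?thesis
        by (metis mon_dvd_eq_add)
    next
      case True
      then have "s < t"
        using assms(8) by simp
      show ?thesis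
      proof (cases "V = {}")
        \<comment> \<open>With no variables, \<open>b = 0\<close> and the given \<open>a\<close>
          serves as \<open>c\<close>.\<close>
        case True
        then have "b = 0"
          using Y(3) keys_b by (metis keys_eq_empty subset_empty)
        with a power show ?thesis
          by (metis add.right_neutral)
      next
        case False
        then obtain z where z: "z \<in> V"
          by blast
        \<comment> \<open>A power of one variable pads \<open>b\<close>, of degree \<open>s\<close>,
          to degree \<open>t - 1\<close>; the subtraction is exact because
          \<open>s < t\<close>.\<close>
        define c where "c = Poly_Mapping.single z (t - 1 - s)"
        have "c + b \<in> monomials V" "Suc (total_degree V (c + b)) = t"
          using z Y \<open>s < t\<close> by (auto simp: c_def keys_add_nat keys_b total_degree_add total_degree_single deg_b)
        then have "c + b \<in> socle V (mon_power (unit_vectors V) t)"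
          by (rule socle_mon_power_unit_vectors[OF Y(1)])
        moreover have "ideal_power R I t = monomial_ideal V (mon_power (unit_vectors V) t)"
          using ideal_power_monomial_ideal[of "unit_vectors V" V t]
          by (simp add: R_def V_def True \<mm>_def maximal_homogeneous_ideal_eq image_subset_iff)
        ultimately show ?thesis
          by blast
      qed
    qed
    then obtain c T where "c + b \<in> socle V T" "ideal_power R I t = monomial_ideal V T"
      by blast
    then show "\<mm> \<in> Ass R (quot_module R (colon R (ideal_power R I t) (\<Prod>i = 1..s. var (y i))))"
      using maximal_homogeneous_ideal_in_Ass_colon[of c b V T] by (simp add: prod R_def \<mm>_def V_def)
  next
    have "mon b \<in> carrier (poly_ring V :: 'k mvpoly ring)"
      using Y(3) keys_b by simp
    from cring.Ass_quot_colon_subset[OF cring_poly_ring ideal_monomial_ideal this]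
    have "Ass R (quot_module R (colon R (ideal_power R I t) (mon b))) \<subseteq>
        Ass R (quot_module R (ideal_power R I t))"
      unfolding power unfolding R_def V_def .
    moreover assume "\<mm> \<in> Ass R (quot_module R (colon R (ideal_power R I t) (\<Prod>i = 1..s. var (y i))))"
    ultimately show "\<mm> \<in> Ass R (quot_module R (ideal_power R I t))"
      unfolding prod by (rule subsetD)
  qed
qed

end
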